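(* Let $J:(0,\infty)\to\mathbb{R}$ be non-constant and satisfy, for all $x,y>0$, $$J(xy)+J(x/y)=2J(x)+2J(y)+2J(x)J(y).$$ Then $J(x)=J(1/x)$ for all $x>0$.
   Context: The displayed functional equation is called the Recognition Composition Law (RCL). *)

theory Defs
  imports "HOL-Analysis.Analysis"
begin

end

theory Submission
  imports Defs
begin

text \<open>The function \<open>H = 1 + J\<close> turns the composition law into d'Alembert's equation
  \<open>H (x y) + H (x / y) = 2 H x H y\<close> on the multiplicative group of positive reals.
  Its value at the unit is pinned by taking \<open>y = 1\<close>: \<open>H x (H 1 - 1) = 0\<close> for every \<open>x\<close>,
  so either \<open>H\<close> vanishes identically, which makes \<open>J\<close> the constant \<open>-1\<close>, or \<open>J 1 = 0\<close>.
  In the latter case, taking \<open>x = 1\<close> compares \<open>J y\<close> with \<open>J (1 / y)\<close> directly.\<close>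

theorem corollaryA2:
  fixes J :: "real \<Rightarrow> real"
  assumes nonconst: "\<not> J constant_on {0<..}"
    and RCL: "\<And>x y. x > 0 \<Longrightarrow> y > 0 \<Longrightarrow>
      J (x * y) + J (x / y) = 2 * J x + 2 * J y + 2 * J x * J y"
  shows "\<forall>x>0. J x = J (1 / x)"
proof -
  obtain z where "z > 0" "J z \<noteq> -1"
    using nonconst unfolding constant_on_def by auto
  moreover have "(1 + J z) * J 1 = 0"
    using RCL[of z 1] \<open>z > 0\<close> by (simp add: algebra_simps)
  ultimately have "J 1 = 0"
    by auto
  then show ?thesis
    using RCL[of 1] by simp
qed

end
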